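(* Let $p\colon[0,1]\to(1,\infty)$ be measurable (so $1<p(t)<\infty$ for a.e. $t$) and let $p^*\colon[0,1]\to(1,\infty)$ be its pointwise Hölder conjugate, $\frac{1}{p(t)}+\frac{1}{p^*(t)}=1$ for a.e. $t\in[0,1]$. Suppose that $f\in L^{p(\cdot)}$ and $g\in L^{p^*(\cdot)}$. Then $$\int_0^1|f(t)g(t)|\,dt\le\|f\|_{p(\cdot)}\,\|g\|_{p^*(\cdot)}.$$
   Context: $L^0$ is the space of Lebesgue measurable functions $[0,1]\to\mathbb{R}$. Let $q\colon[0,1]\to[1,\infty)$ be measurable and $f\in L^0$. For $x_0>0$, a solution with initial value $x_0$ (weak, in the sense of Carathéodory) is an absolutely continuous function $\varphi_{f,x_0}\colon[0,1]\to(0,\infty)$ with $\varphi_{f,x_0}(T)=x_0+\int_0^T \frac{|f(t)|^{q(t)}}{q(t)}\varphi_{f,x_0}(t)^{1-q(t)}\,dt$ for all $T\in[0,1]$; it is unique if it exists. If it exists for every $x_0>0$, then as $x_0\searrow0$ the functions $\varphi_{f,x_0}$ decrease to an absolutely continuous function $\varphi_f$ which solves $\varphi'(t)=\frac{|f(t)|^{q(t)}}{q(t)}\varphi(t)^{1-q(t)}$ for a.e. $t$, with $\varphi(0)=0$ (the right-hand side is read as $0$ where $f(t)=0$); this is called the solution with initial value $0^+$. The ODE-determined class $L^{q(\cdot)}\subset L^0$ consists of those $f$ for which $\varphi_f$ exists, i.e. for which $\varphi_{f,x_0}$ exists on $[0,1]$ for every $x_0>0$. For $f\in L^{q(\cdot)}$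 put $\|f\|_{q(\cdot)}:=\varphi_f(1)$; this notation is used even when $L^{q(\cdot)}$ is not a linear space. *)

theory Defs
  imports "HOL-Analysis.Analysis"
begin

text \<open>
  Functions on \<open>[0,1]\<close> that are merely given data (the exponents and \<open>f\<close>, \<open>g\<close>) are represented by
  functions of type \<^typ>\<open>real \<Rightarrow> real\<close> whose values outside \<open>[0,1]\<close> are never used.
\<close>

definition absolutely_continuous_fun :: "real \<Rightarrow> real \<Rightarrow> (real \<Rightarrow> real) \<Rightarrow> bool" where
  "absolutely_continuous_fun u v \<phi> \<longleftrightarrow>
    (\<forall>\<epsilon>>0. \<exists>\<delta>>0. \<forall>D :: (real \<times> real) set.
      finite D \<and> (\<forall>(a, b) \<in> D. u \<le> a \<and> a \<le> b \<and> b \<le> v) \<and>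
      disjoint_family_on (\<lambda>(a, b). {a<..<b}) D \<and>
      (\<Sum>(a, b) \<in> D. b - a) < \<delta> \<longrightarrow>
      (\<Sum>(a, b) \<in> D. \<bar>\<phi> b - \<phi> a\<bar>) < \<epsilon>)"

text \<open>
  The right-hand side \<open>|f(t)|^{q(t)}/q(t) * \<phi>(t)^{1-q(t)}\<close> of the equation. For \<open>\<phi>(t) > 0\<close> and
  \<open>q(t) \<ge> 1\<close>, \<open>powr\<close> is the ordinary power, and \<^term>\<open>0 powr x = (0::real)\<close> makes the term \<open>0\<close> where
  \<open>f(t) = 0\<close>.
\<close>

definition ode_rhs :: "(real \<Rightarrow> real) \<Rightarrow> (real \<Rightarrow> real) \<Rightarrow> (real \<Rightarrow> real) \<Rightarrow> real \<Rightarrow> real" where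
  "ode_rhs q f \<phi> t = \<bar>f t\<bar> powr q t / q t * \<phi> t powr (1 - q t)"

text \<open>
  Integrability is required separately, because the Lebesgue integral of a non-integrable function
  is \<open>0\<close> by convention. Solutions are extensional functions on \<open>[0,1]\<close>, so that uniqueness
  on \<open>[0,1]\<close> is uniqueness as a HOL function.
\<close>

definition is_ode_solution ::
    "(real \<Rightarrow> real) \<Rightarrow> (real \<Rightarrow> real) \<Rightarrow> real \<Rightarrow> (real \<Rightarrow> real) \<Rightarrow> bool" where
  "is_ode_solution q f x\<^sub>0 \<phi> \<longleftrightarrow>
    \<phi> \<in> {0..1} \<rightarrow>\<^sub>E {0<..} \<and>
    absolutely_continuous_fun 0 1 \<phi> \<and>
    set_integrable lebesgue {0..1} (ode_rhs q f \<phi>) \<and>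
    (\<forall>T\<in>{0..1}. \<phi> T = x\<^sub>0 + (LINT t:{0..T}|lebesgue. ode_rhs q f \<phi> t))"

definition ode_solution :: "(real \<Rightarrow> real) \<Rightarrow> (real \<Rightarrow> real) \<Rightarrow> real \<Rightarrow> real \<Rightarrow> real" where
  "ode_solution q f x\<^sub>0 = (THE \<phi>. is_ode_solution q f x\<^sub>0 \<phi>)"

definition ode_class :: "(real \<Rightarrow> real) \<Rightarrow> (real \<Rightarrow> real) set" where
  "ode_class q =
    {f \<in> borel_measurable (lebesgue_on {0..1}). \<forall>x\<^sub>0>0. \<exists>\<phi>. is_ode_solution q f x\<^sub>0 \<phi>}"

text \<open>The solution with initial value \<open>0\<^sup>+\<close>; meaningful for \<open>f \<in> ode_class q\<close>.\<close>

definition ode_solution_zero :: "(real \<Rightarrow> real) \<Rightarrow> (real \<Rightarrow> real) \<Rightarrow> real \<Rightarrow> real" where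
  "ode_solution_zero q f t = Lim (at_right 0) (\<lambda>x\<^sub>0. ode_solution q f x\<^sub>0 t)"

definition ode_norm :: "(real \<Rightarrow> real) \<Rightarrow> (real \<Rightarrow> real) \<Rightarrow> real" where
  "ode_norm q f = ode_solution_zero q f 1"

end

theory Submission
  imports Defs
begin

text \<open>
  If \<open>\<phi>\<close> and \<open>\<psi>\<close> are the solutions with initial value \<open>x > 0\<close> for \<open>(p, f)\<close> and \<open>(p\<^sup>*, g)\<close>, then
  Young's inequality applied to \<open>|f|/\<phi>\<close> and \<open>|g|/\<psi>\<close> gives
  \<open>|f g| \<le> \<phi> \<psi> (|f/\<phi>|\<^sup>p / p + |g/\<psi>|\<^sup>p\<^sup>* / p\<^sup>*) = \<phi>' \<psi> + \<phi> \<psi>' = (\<phi> \<psi>)'\<close>.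
  Integrating, \<open>\<integral> |f g| \<le> \<phi>(1) \<psi>(1)\<close>, and \<open>x\<close> tends to \<open>0\<close>. The limits exist because solutions
  depend monotonically on the initial value: the right-hand side of the equation decreases in \<open>\<phi>\<close>.
\<close>

section \<open>Elementary properties of solutions\<close>

lemma absolutely_continuous_fun_imp_continuous_on:
  assumes "absolutely_continuous_fun u v \<phi>"
  shows "continuous_on {u..v} \<phi>"
  unfolding continuous_on_iff
proof (intro ballI allI impI)
  fix x e :: real
  assume x: "x \<in> {u..v}" and e: "0 < e"
  obtain d where d: "d > 0" and D: "\<And>D :: (real \<times> real) set.
      finite D \<and> (\<forall>(a, b) \<in> D. u \<le> a \<and> a \<le> b \<and> b \<le> v) \<and>
      disjoint_family_on (\<lambda>(a, b). {a<..<b}) D \<and>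
      (\<Sum>(a, b) \<in> D. b - a) < d \<Longrightarrow> (\<Sum>(a, b) \<in> D. \<bar>\<phi> b - \<phi> a\<bar>) < e"
    using assms e unfolding absolutely_continuous_fun_def by meson
  \<comment> \<open>A family consisting of one interval, with endpoints \<open>x\<close> and
    \<open>y\<close> in increasing order, is enough.\<close>
  have "dist (\<phi> y) (\<phi> x) < e" if "y \<in> {u..v}" "dist y x < d" for y
    using D[of "{(min x y, max x y)}"] x that
    by (cases "x \<le> y") (auto simp: disjoint_family_on_def dist_real_def abs_minus_commute)
  then show "\<exists>d>0. \<forall>y\<in>{u..v}. dist y x < d \<longrightarrow> dist (\<phi> y) (\<phi> x) < e"
    using d by blast
qed

lemma ode_solution_pos:
  assumes "is_ode_solution q f x \<phi>" "t \<in> {0..1}"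
  shows "\<phi> t > 0"
  using assms unfolding is_ode_solution_def by (blast dest: PiE_mem)

lemma ode_rhs_nonneg:
  assumes "q t \<ge> 0"
  shows "ode_rhs q f \<phi> t \<ge> 0"
  using assms by (simp add: ode_rhs_def)

lemma ode_rhs_antimono:
  assumes "q t \<ge> 1" "0 < \<psi> t" "\<psi> t \<le> \<phi> t"
  shows "ode_rhs q f \<phi> t \<le> ode_rhs q f \<psi> t"
  unfolding ode_rhs_def using assms by (intro mult_left_mono powr_mono2') auto

text \<open>Restarts the integral equation at an interior time \<open>s\<close>, as the comparison
  argument requires. The interval is half-open so that it is disjoint from
  \<open>{0..s}\<close>.\<close>

lemma ode_solution_increment:
  assumes sol: "is_ode_solution q f x \<phi>" and st: "0 \<le> s" "s \<le> t" "t \<le> 1"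
  shows "\<phi> t = \<phi> s + (LINT r:{s<..t}|lebesgue. ode_rhs q f \<phi> r)"
proof -
  have int: "set_integrable lebesgue {0..1} (ode_rhs q f \<phi>)"
    and eq: "\<And>T. T \<in> {0..1} \<Longrightarrow> \<phi> T = x + (LINT t:{0..T}|lebesgue. ode_rhs q f \<phi> t)"
    using sol by (auto simp: is_ode_solution_def)
  have "{0..t} = {0..s} \<union> {s<..t}"
    using st by auto
  moreover have "set_integrable lebesgue {0..s} (ode_rhs q f \<phi>)"
    "set_integrable lebesgue {s<..t} (ode_rhs q f \<phi>)"
    using st by (auto intro!: set_integrable_subset[OF int])
  moreover have "{0..s} \<inter> {s<..t} = {}"
    by auto
  ultimately have "(LINT r:{0..t}|lebesgue. ode_rhs q f \<phi> r) =
      (LINT r:{0..s}|lebesgue. ode_rhs q f \<phi> r) + (LINT r:{s<..t}|lebesgue. ode_rhs q f \<phi> r)"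
    by (simp only: set_integral_Un)
  then show ?thesis
    using eq[of s] eq[of t] st by simp
qed

lemma ode_solution_at_0:
  assumes "is_ode_solution q f x \<phi>"
  shows "\<phi> 0 = x"
proof -
  have "AE t in lebesgue. t \<noteq> (0::real)"
    using AE_lborel_singleton AE_completion by blast
  then have "(LINT t:{0..0}|lebesgue. ode_rhs q f \<phi> t) = 0"
    unfolding set_lebesgue_integral_def
    by (intro integral_eq_zero_AE) (auto elim!: eventually_mono simp del: atLeastAtMost_singleton)
  then show ?thesis
    using assms by (auto simp: is_ode_solution_def)
qed

section \<open>Comparison, uniqueness and the limit of vanishing initial value\<close>

text \<open>Let \<open>s\<close> be the last time up to \<open>T\<close> with
  \<open>\<phi> s \<le> \<psi> s\<close>; it exists by continuity and compactness. After
  \<open>s\<close> the function \<phi> lies above \<psi>, so its right-hand side is at most that of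
  \<psi>, and \<phi> cannot end up above \<psi> at \<open>T\<close>.\<close>

lemma ode_solution_mono:
  assumes q: "\<forall>t\<in>{0..1}. 1 \<le> q t"
    and \<phi>: "is_ode_solution q f x \<phi>" and \<psi>: "is_ode_solution q f y \<psi>"
    and xy: "x \<le> y" and T: "T \<in> {0..1}"
  shows "\<phi> T \<le> \<psi> T"
proof (rule ccontr)
  assume neg: "\<not> \<phi> T \<le> \<psi> T"
  define A where "A = {t \<in> {0..T}. \<phi> t \<le> \<psi> t}"
  have "continuous_on {0..T} \<phi>" "continuous_on {0..T} \<psi>"
    using \<phi> \<psi> T absolutely_continuous_fun_imp_continuous_on
    by (auto simp: is_ode_solution_def intro: continuous_on_subset[where s = "{0..1}"])
  then have "closed A"
    unfolding A_def by (intro continuous_on_closed_Collect_le) auto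
  moreover have "bounded A"
    unfolding A_def by (rule bounded_subset[OF bounded_closed_interval[of 0 T]]) auto
  ultimately have "compact A"
    by (simp add: compact_eq_bounded_closed)
  moreover have "0 \<in> A"
    using xy T ode_solution_at_0[OF \<phi>] ode_solution_at_0[OF \<psi>] by (auto simp: A_def)
  ultimately obtain s where s: "s \<in> A" and max: "\<And>t. t \<in> A \<Longrightarrow> t \<le> s"
    using compact_attains_sup[of A] by blast
  have int: "set_integrable lebesgue {s<..T} (ode_rhs q f \<phi>)"
      "set_integrable lebesgue {s<..T} (ode_rhs q f \<psi>)"
    using \<phi> \<psi> s T unfolding is_ode_solution_def
    by (auto intro!: set_integrable_subset[where A = "{0..1}"] simp: A_def)
  have "(LINT t:{s<..T}|lebesgue. ode_rhs q f \<phi> t) \<le> (LINT t:{s<..T}|lebesgue. ode_rhs q f \<psi> t)"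
  proof (rule set_integral_mono[OF int])
    fix t assume t: "t \<in> {s<..T}"
    then have t01: "t \<in> {0..1}"
      using s T by (auto simp: A_def)
    have "\<psi> t \<le> \<phi> t"
      using max[of t] t t01 by (force simp: A_def)
    then show "ode_rhs q f \<phi> t \<le> ode_rhs q f \<psi> t"
      using q t01 ode_solution_pos[OF \<psi> t01] by (intro ode_rhs_antimono) auto
  qed
  moreover have "\<phi> s \<le> \<psi> s" "0 \<le> s" "s \<le> T" "T \<le> 1"
    using s T by (auto simp: A_def)
  ultimately have "\<phi> T \<le> \<psi> T"
    using ode_solution_increment[OF \<phi>, of s T] ode_solution_increment[OF \<psi>, of s T] by linarith
  then show False
    using neg by simp
qed

text \<open>Comparison in both directions with equal initial values gives uniqueness on
  \<open>{0..1}\<close>; extensionality settles the other arguments. Hence the \<open>THE\<close> in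
  \<open>ode_solution\<close> is well defined.\<close>

lemma is_ode_solution_ode_solution:
  assumes q: "\<forall>t\<in>{0..1}. 1 \<le> q t" and f: "f \<in> ode_class q" and x: "x > 0"
  shows "is_ode_solution q f x (ode_solution q f x)"
proof -
  obtain \<phi> where \<phi>: "is_ode_solution q f x \<phi>"
    using f x by (auto simp: ode_class_def)
  have "\<psi> = \<phi>" if \<psi>: "is_ode_solution q f x \<psi>" for \<psi>
  proof (rule PiE_ext)
    show "\<psi> \<in> {0..1} \<rightarrow>\<^sub>E {0<..}" "\<phi> \<in> {0..1} \<rightarrow>\<^sub>E {0<..}"
      using \<phi> \<psi> by (auto simp: is_ode_solution_def)
    show "\<psi> t = \<phi> t" if "t \<in> {0..1}" for t
      using ode_solution_mono[OF q \<phi> \<psi> order_refl that] ode_solution_mono[OF q \<psi> \<phi> order_refl that]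
      by simp
  qed
  then show ?thesis
    unfolding ode_solution_def using \<phi> by (metis theI)
qed

text \<open>The value at time 1 is nondecreasing in the initial value and bounded below by 0, so it
  converges to its infimum. Existence of this limit gives the \<open>Lim\<close> in
  \<open>ode_solution_zero\<close> its meaning.\<close>

lemma ode_norm_tendsto:
  assumes q: "\<forall>t\<in>{0..1}. 1 \<le> q t" and f: "f \<in> ode_class q"
  shows "((\<lambda>x. ode_solution q f x 1) \<longlongrightarrow> ode_norm q f) (at_right 0)"
proof -
  define F where "F = (\<lambda>x. ode_solution q f x 1)"
  have sol: "is_ode_solution q f x (ode_solution q f x)" if "x > 0" for x
    using is_ode_solution_ode_solution[OF q f that] .
  have mono: "F x \<le> F y" if "0 < x" "x \<le> y" for x y
    unfolding F_def using ode_solution_mono[OF q sol sol] that by auto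
  have "F x \<ge> 0" if "x > 0" for x
    using ode_solution_pos[OF sol[OF that]] by (auto simp: F_def less_imp_le)
  then have bdd: "bdd_below (F ` {0<..})"
    by (intro bdd_belowI[of _ 0]) auto
  have "(F \<longlongrightarrow> Inf (F ` {0<..})) (at_right 0)"
  proof (rule decreasing_tendsto)
    show "\<forall>\<^sub>F x in at_right 0. Inf (F ` {0<..}) \<le> F x"
      unfolding eventually_at_filter
      by (intro always_eventually) (auto intro!: cInf_lower bdd)
    fix z assume "Inf (F ` {0<..}) < z"
    then obtain y where y: "y > 0" "F y < z"
      using cInf_lessD[of "F ` {0<..}" z] by auto
    then have "F x < z" if "x > 0" "x < y" for x
      using mono[of x y] that by auto
    then show "\<forall>\<^sub>F x in at_right 0. F x < z"
      using y(1) by (auto simp: eventually_at_right)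
  qed
  then have "(F \<longlongrightarrow> Lim (at_right 0) F) (at_right 0)"
    by (simp add: tendsto_Lim)
  then show ?thesis
    by (simp add: F_def ode_norm_def ode_solution_zero_def)
qed

section \<open>Integration by parts for nonnegative functions\<close>

text \<open>Makes Tonelli's theorem available for \<open>lebesgue\<close>, the completion of
  \<open>lborel\<close>: the same countable cover works, as both measures agree on
  \<open>sets M\<close>.\<close>

lemma sigma_finite_completion:
  assumes "sigma_finite_measure M"
  shows "sigma_finite_measure (completion M)"
proof -
  obtain A where "countable A" "A \<subseteq> sets M" "\<Union>A = space M" "\<forall>a\<in>A. emeasure M a \<noteq> \<infinity>"
    using assms unfolding sigma_finite_measure_def by blast
  then show ?thesis
    unfolding sigma_finite_measure_def
    by (intro exI[of _ A]) (auto simp: emeasure_completion main_part_sets)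
qed

text \<open>
  Integration by parts for two primitives, without derivatives: \<open>u(t) v(s)\<close> is integrated over
  the two triangles \<open>s \<le> t\<close> and \<open>s \<ge> t\<close>.
\<close>

lemma nn_integral_primitives_product:
  fixes u v :: "real \<Rightarrow> ennreal"
  assumes [measurable]: "u \<in> borel_measurable lebesgue" "v \<in> borel_measurable lebesgue"
  shows "(\<integral>\<^sup>+t. u t * (\<integral>\<^sup>+s. v s * indicator {..t} s \<partial>lebesgue) +
      v t * (\<integral>\<^sup>+s. u s * indicator {..t} s \<partial>lebesgue) \<partial>lebesgue) =
    (\<integral>\<^sup>+t. u t \<partial>lebesgue) * (\<integral>\<^sup>+t. v t \<partial>lebesgue)"
proof -
  interpret sigma_finite_measure "lebesgue :: real measure"
    by (intro sigma_finite_completion sigma_finite_lborel)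
  interpret pair_sigma_finite "lebesgue :: real measure" "lebesgue :: real measure" ..
  \<comment> \<open>Gives joint measurability of the condition \<open>s \<le> t\<close> on the
    product of two copies of \<open>lebesgue\<close>.\<close>
  have [measurable]: "(\<lambda>z. z) \<in> borel_measurable (lebesgue :: real measure)"
    by (simp add: measurable_completion)
  have swap: "(\<integral>\<^sup>+t. v t * (\<integral>\<^sup>+s. u s * indicator {..t} s \<partial>lebesgue) \<partial>lebesgue) =
      (\<integral>\<^sup>+t. u t * (\<integral>\<^sup>+s. v s * indicator {t..} s \<partial>lebesgue) \<partial>lebesgue)"
  proof -
    have "(\<integral>\<^sup>+t. v t * (\<integral>\<^sup>+s. u s * indicator {..t} s \<partial>lebesgue) \<partial>lebesgue) =
        (\<integral>\<^sup>+t. (\<integral>\<^sup>+s. v t * (u s * indicator {..t} s) \<partial>lebesgue) \<partial>lebesgue)"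
      by (simp add: nn_integral_cmult)
    also have "\<dots> = (\<integral>\<^sup>+s. (\<integral>\<^sup>+t. v t * (u s * indicator {..t} s) \<partial>lebesgue) \<partial>lebesgue)"
      unfolding indicator_def atMost_iff by (rule Fubini') measurable
    also have "\<dots> = (\<integral>\<^sup>+s. (\<integral>\<^sup>+t. u s * (v t * indicator {s..} t) \<partial>lebesgue) \<partial>lebesgue)"
      by (intro nn_integral_cong) (auto simp: indicator_def mult.commute)
    finally show ?thesis
      by (simp add: nn_integral_cmult)
  qed
  \<comment> \<open>The two half-lines overlap only in the null set \<open>{t}\<close>.\<close>
  have split: "(\<integral>\<^sup>+s. v s * indicator {..t} s \<partial>lebesgue) + (\<integral>\<^sup>+s. v s * indicator {t..} s \<partial>lebesgue) =
      (\<integral>\<^sup>+s. v s \<partial>lebesgue)" for t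
  proof -
    have "AE s in lebesgue. s \<noteq> t"
      using AE_lborel_singleton AE_completion by blast
    then have "(\<integral>\<^sup>+s. v s * indicator {..t} s + v s * indicator {t..} s \<partial>lebesgue) = (\<integral>\<^sup>+s. v s \<partial>lebesgue)"
      by (intro nn_integral_cong_AE) (auto elim!: eventually_mono simp: indicator_def)
    then show ?thesis
      by (simp add: nn_integral_add)
  qed
  have [measurable]: "(\<lambda>t. \<integral>\<^sup>+s. v s * indicator {..t} s \<partial>lebesgue) \<in> borel_measurable lebesgue"
    "(\<lambda>t. \<integral>\<^sup>+s. u s * indicator {..t} s \<partial>lebesgue) \<in> borel_measurable lebesgue"
    "(\<lambda>t. \<integral>\<^sup>+s. v s * indicator {t..} s \<partial>lebesgue) \<in> borel_measurable lebesgue"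
    unfolding indicator_def atMost_iff atLeast_iff by measurable
  show ?thesis
    \<comment> \<open>The sum is first taken apart so that \<open>swap\<close> applies, then
      reassembled with \<open>u t\<close> factored out; by \<open>split\<close> the inner integral
      no longer depends on \<open>t\<close>.\<close>
    by (simp add: nn_integral_add swap)
      (simp add: nn_integral_add[symmetric] distrib_left[symmetric] split nn_integral_multc)
qed

section \<open>Young's inequality and the bound for positive initial values\<close>

text \<open>Puts the integral equation in the form used for integration by parts: an integrand on
  the whole line, cut off at \<open>T\<close> only by \<open>indicator {..T}\<close>.\<close>

lemma ode_solution_eq_nn_integral:
  assumes q: "\<forall>t\<in>{0..1}. 1 \<le> q t" and sol: "is_ode_solution q f x \<phi>" and x: "x \<ge> 0"
    and T: "T \<in> {0..1}"
  shows "ennreal (\<phi> T) =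
    ennreal x + (\<integral>\<^sup>+t. ennreal (indicator {0..1} t * ode_rhs q f \<phi> t) * indicator {..T} t \<partial>lebesgue)"
proof -
  have int: "set_integrable lebesgue {0..T} (ode_rhs q f \<phi>)"
    using sol T unfolding is_ode_solution_def
    by (auto intro!: set_integrable_subset[where A = "{0..1}"])
  have nn: "0 \<le> indicator {0..T} t * ode_rhs q f \<phi> t" for t
    using q T by (metis (no_types, opaque_lifting) atLeastAtMost_iff indicator_simps mult_1
        mult_zero_left ode_rhs_nonneg order.refl order.trans zero_le_one)
  have "\<phi> T = x + (LINT t|lebesgue. indicator {0..T} t * ode_rhs q f \<phi> t)"
    using sol T by (simp add: is_ode_solution_def set_lebesgue_integral_def)
  then have "ennreal (\<phi> T) = ennreal x + ennreal (LINT t|lebesgue. indicator {0..T} t * ode_rhs q f \<phi> t)"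
    using x nn by (simp add: ennreal_plus)
  also have "ennreal (LINT t|lebesgue. indicator {0..T} t * ode_rhs q f \<phi> t) =
      (\<integral>\<^sup>+t. ennreal (indicator {0..T} t * ode_rhs q f \<phi> t) \<partial>lebesgue)"
    using int nn by (intro nn_integral_eq_integral[symmetric]) (auto simp: set_integrable_def)
  also have "\<dots> = (\<integral>\<^sup>+t. ennreal (indicator {0..1} t * ode_rhs q f \<phi> t) * indicator {..T} t \<partial>lebesgue)"
    using T by (intro nn_integral_cong) (auto simp: indicator_def)
  finally show ?thesis .
qed

lemma Youngs_inequality_ode_rhs:
  assumes "p t > 1" "q t > 1" "1 / p t + 1 / q t = 1" "\<phi> t > 0" "\<psi> t > 0"
  shows "\<bar>f t * g t\<bar> \<le> ode_rhs p f \<phi> t * \<psi> t + ode_rhs q g \<psi> t * \<phi> t"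
proof -
  \<comment> \<open>One factor \<open>y\<close> turns \<open>y powr (- r)\<close> into the power
    \<open>1 - r\<close> occurring in \<open>ode_rhs\<close>.\<close>
  have rhs: "(\<bar>h\<bar> / y) powr r / r * y = \<bar>h\<bar> powr r / r * y powr (1 - r)" if "y > 0" for h y r :: real
    using that by (simp add: powr_divide powr_diff)
  have split: "(a + b) * (c * d) = (a * c) * d + (b * d) * c" for a b c d :: real
    by (simp add: algebra_simps)
  have "(\<bar>f t\<bar> / \<phi> t) * (\<bar>g t\<bar> / \<psi> t) * (\<phi> t * \<psi> t) \<le>
      ((\<bar>f t\<bar> / \<phi> t) powr p t / p t + (\<bar>g t\<bar> / \<psi> t) powr q t / q t) * (\<phi> t * \<psi> t)"
    using assms by (intro mult_right_mono Youngs_inequality) auto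
  also have "\<dots> = ((\<bar>f t\<bar> / \<phi> t) powr p t / p t * \<phi> t) * \<psi> t +
      ((\<bar>g t\<bar> / \<psi> t) powr q t / q t * \<psi> t) * \<phi> t"
    by (rule split)
  also have "\<dots> = ode_rhs p f \<phi> t * \<psi> t + ode_rhs q g \<psi> t * \<phi> t"
    using assms rhs by (simp only: ode_rhs_def)
  finally show ?thesis
    using assms by (simp add: abs_mult)
qed

text \<open>With \<phi> = x + U and \<psi> = y + V, where U and V are the primitives of u and v,
  Young's bound u \<psi> + v \<phi> becomes (y u + x v) + (u V + v U), and the last bracket
  integrates to U(1) V(1).\<close>

lemma nn_integral_mult_le_ode_solutions:
  assumes p: "\<forall>t\<in>{0..1}. 1 < p t" and q: "\<forall>t\<in>{0..1}. 1 < q t"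
    and conj: "AE t in lebesgue_on {0..1}. 1 / p t + 1 / q t = 1"
    and \<phi>: "is_ode_solution p f x \<phi>" and \<psi>: "is_ode_solution q g y \<psi>" and xy: "x \<ge> 0" "y \<ge> 0"
  shows "(\<integral>\<^sup>+ t. ennreal \<bar>f t * g t\<bar> \<partial>lebesgue_on {0..1}) \<le> ennreal (\<phi> 1 * \<psi> 1)"
proof -
  define u where "u = (\<lambda>t. ennreal (indicator {0..1} t * ode_rhs p f \<phi> t))"
  define v where "v = (\<lambda>t. ennreal (indicator {0..1} t * ode_rhs q g \<psi> t))"
  define U where "U = (\<lambda>t. \<integral>\<^sup>+s. u s * indicator {..t} s \<partial>lebesgue)"
  define V where "V = (\<lambda>t. \<integral>\<^sup>+s. v s * indicator {..t} s \<partial>lebesgue)"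
  have p1: "\<forall>t\<in>{0..1}. 1 \<le> p t" and q1: "\<forall>t\<in>{0..1}. 1 \<le> q t"
    using p q by (auto simp: less_imp_le)
  have um [measurable]: "u \<in> borel_measurable lebesgue" and vm [measurable]: "v \<in> borel_measurable lebesgue"
    using \<phi> \<psi> unfolding u_def v_def is_ode_solution_def set_integrable_def
    by (auto intro!: measurable_compose[OF _ measurable_ennreal] dest: borel_measurable_integrable)
  have \<phi>U: "ennreal (\<phi> t) = ennreal x + U t" and \<psi>V: "ennreal (\<psi> t) = ennreal y + V t"
    if "t \<in> {0..1}" for t
    using ode_solution_eq_nn_integral[OF p1 \<phi> xy(1) that]
      ode_solution_eq_nn_integral[OF q1 \<psi> xy(2) that]
    by (auto simp: u_def v_def U_def V_def)
  \<comment> \<open>Both densities vanish outside \<open>{0..1}\<close>.\<close>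
  have U1: "U 1 = (\<integral>\<^sup>+s. u s \<partial>lebesgue)" and V1: "V 1 = (\<integral>\<^sup>+s. v s \<partial>lebesgue)"
    unfolding U_def V_def u_def v_def by (auto intro!: nn_integral_cong simp: indicator_def)
  interpret sigma_finite_measure "lebesgue :: real measure"
    by (intro sigma_finite_completion sigma_finite_lborel)
  have [measurable]: "(\<lambda>z. z) \<in> borel_measurable (lebesgue :: real measure)"
    by (simp add: measurable_completion)
  have [measurable]: "U \<in> borel_measurable lebesgue" "V \<in> borel_measurable lebesgue"
    unfolding U_def V_def indicator_def atMost_iff by measurable
  have prod: "(\<integral>\<^sup>+ t. u t * V t + v t * U t \<partial>lebesgue) = U 1 * V 1"
    unfolding U1 V1 unfolding U_def V_def by (rule nn_integral_primitives_product[OF um vm])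
  have "AE t in lebesgue. t \<in> {0..1} \<longrightarrow> 1 / p t + 1 / q t = 1"
    using conj by (simp add: AE_restrict_space_iff)
  then have "(\<integral>\<^sup>+ t. ennreal \<bar>f t * g t\<bar> * indicator {0..1} t \<partial>lebesgue) \<le>
      (\<integral>\<^sup>+ t. (ennreal y * u t + ennreal x * v t) + (u t * V t + v t * U t) \<partial>lebesgue)"
  proof (intro nn_integral_mono_AE, elim eventually_mono)
    fix t assume conj_t: "t \<in> {0..1} \<longrightarrow> 1 / p t + 1 / q t = 1"
    show "ennreal \<bar>f t * g t\<bar> * indicator {0..1} t \<le>
        (ennreal y * u t + ennreal x * v t) + (u t * V t + v t * U t)"
    proof (cases "t \<in> {0..1}")
      case True
      have pos: "\<phi> t > 0" "\<psi> t > 0" and pq: "1 < p t" "1 < q t"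
        using ode_solution_pos \<phi> \<psi> p q True by auto
      have nn: "0 \<le> ode_rhs p f \<phi> t" "0 \<le> ode_rhs q g \<psi> t"
        using pq by (auto intro!: ode_rhs_nonneg)
      have "ennreal \<bar>f t * g t\<bar> \<le> ennreal (ode_rhs p f \<phi> t * \<psi> t + ode_rhs q g \<psi> t * \<phi> t)"
        using Youngs_inequality_ode_rhs[of p t q \<phi> \<psi> f g] conj_t True pos pq by (intro ennreal_leI) auto
      also have "\<dots> = u t * ennreal (\<psi> t) + v t * ennreal (\<phi> t)"
        using nn pos True by (simp add: u_def v_def ennreal_mult)
      finally show ?thesis
        using \<phi>U \<psi>V True by (simp add: distrib_left ac_simps)
    qed simp
  qed
  also have "\<dots> = ennreal y * U 1 + ennreal x * V 1 + U 1 * V 1"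
    by (subst nn_integral_add) (simp_all add: prod nn_integral_add[of "\<lambda>t. ennreal y * u t"] nn_integral_cmult
        flip: U1 V1)
  \<comment> \<open>Expanding \<open>(x + U 1) * (y + V 1)\<close> leaves only the nonnegative
    surplus \<open>x * y\<close>.\<close>
  also have "\<dots> \<le> ennreal (\<phi> 1) * ennreal (\<psi> 1)"
    by (simp add: \<phi>U \<psi>V distrib_left distrib_right ac_simps add_increasing)
  also have "\<dots> = ennreal (\<phi> 1 * \<psi> 1)"
    using ode_solution_pos[OF \<phi>, of 1] ode_solution_pos[OF \<psi>, of 1] by (simp add: ennreal_mult)
  finally show ?thesis
    by (simp add: nn_integral_restrict_space)
qed

text \<open>With a nonnegative extended integral on the left, finiteness is part of the claim; a
  Bochner integral would default to 0 for a non-integrable product.\<close>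

theorem proposition3p1:
  fixes p pstar f g :: "real \<Rightarrow> real"
  assumes "p \<in> borel_measurable (lebesgue_on {0..1})"
    and "\<forall>t\<in>{0..1}. 1 < p t"
    and "\<forall>t\<in>{0..1}. 1 < pstar t"
    and "AE t in lebesgue_on {0..1}. 1 / p t + 1 / pstar t = 1"
    and "f \<in> ode_class p"
    and "g \<in> ode_class pstar"
  shows "(\<integral>\<^sup>+ t. ennreal \<bar>f t * g t\<bar> \<partial>lebesgue_on {0..1}) \<le> ennreal (ode_norm p f * ode_norm pstar g)"
proof (rule tendsto_lowerbound)
  have p: "\<forall>t\<in>{0..1}. 1 \<le> p t" and q: "\<forall>t\<in>{0..1}. 1 \<le> pstar t"
    using assms(2,3) by (auto simp: less_imp_le)
  show "((\<lambda>x. ennreal (ode_solution p f x 1 * ode_solution pstar g x 1)) \<longlongrightarrow>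
      ennreal (ode_norm p f * ode_norm pstar g)) (at_right 0)"
    using assms p q by (intro tendsto_ennrealI tendsto_mult ode_norm_tendsto)
  \<comment> \<open>Both solutions start from the same \<open>x\<close>, so a single one-sided limit
    suffices.\<close>
  have "(\<integral>\<^sup>+ t. ennreal \<bar>f t * g t\<bar> \<partial>lebesgue_on {0..1}) \<le>
      ennreal (ode_solution p f x 1 * ode_solution pstar g x 1)" if "x > 0" for x
    using nn_integral_mult_le_ode_solutions[OF assms(2-4) is_ode_solution_ode_solution[OF p assms(5) that]
        is_ode_solution_ode_solution[OF q assms(6) that]] that
    by simp
  then show "\<forall>\<^sub>F x in at_right 0. (\<integral>\<^sup>+ t. ennreal \<bar>f t * g t\<bar> \<partial>lebesgue_on {0..1}) \<le>
      ennreal (ode_solution p f x 1 * ode_solution pstar g x 1)"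
    by (auto simp: eventually_at_filter)
qed simp

end
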